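(* Let $\mathbb{G}=(G_1,G_0)$ be a group-groupoid. Let $\mathcal{W}(\mathbb{G})$ be the group of regular natural transformations of $\mathbb{G}$ (with horizontal composition as group operation) and $\operatorname{Aut}(\mathbb{G})$ the group of automorphisms of $\mathbb{G}$ (with composition as group operation). For $\eta\in\mathcal{W}(\mathbb{G})$ with $\eta\colon f\Rightarrow g$ put $\widetilde{d_0}(\eta)=f$ and $\widetilde{d_1}(\eta)=g$; for $f\in\operatorname{Aut}(\mathbb{G})$ put $\widetilde{\varepsilon}(f)=1_f$ (the identity natural transformation of $f$); and for $\eta\colon f\Rightarrow g$ and $\eta'\colon g\Rightarrow h$ in $\mathcal{W}(\mathbb{G})$ put $\widetilde{m}(\eta',\eta)=\eta'\,\widetilde{\circ}\,\eta=\eta'\circ_v\eta$ (vertical composition). Then $(\mathcal{W}(\mathbb{G}),\operatorname{Aut}(\mathbb{G}),\widetilde{d_0},\widetilde{d_1},\widetilde{\varepsilon},\widetilde{m})$ is a group-groupoid, with group of morphisms $\mathcal{W}(\mathbb{G})$ and group of objects $\operatorname{Aut}(\mathbb{G})$.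
   Context: A group-groupoid $\mathbb{G}=(G_1,G_0)$ is an internal category (groupoid) in the category of groups: a groupoid with set of morphisms $G_1$ and set of objects $G_0$, both equipped with (not necessarily abelian, additively written) group structures, such that the source map $d_0\colon G_1\to G_0$, the target map $d_1\colon G_1\to G_0$, the identity map $\varepsilon\colon G_0\to G_1$, $\varepsilon(x)=1_x$, and the composition $m(b,a)=b\circ a$ (defined on the pullback of pairs $(b,a)$ with $d_0(b)=d_1(a)$) are group homomorphisms. A morphism of group-groupoids is a functor $f=(f_1,f_0)$ with $f_1,f_0$ group homomorphisms; one writes $f$ for either component. It is an isomorphism if $f_1$ and $f_0$ are; $\operatorname{Aut}(\mathbb{G})$ is the group of automorphisms of $\mathbb{G}$. $\operatorname{Nat}(\mathbb{G})$ is the set of natural transformations $\eta\colon f\Rightarrow g$ between group-groupoid morphisms $f,g\colon\mathbb{G}\to\mathbb{G}$ (source $f$ and target $g$ being part of the data): families of morphisms $\eta(x)\colon f(x)\to g(x)$, $x\in G_0$, with $\eta(y)\circ f(a)=g(a)\circ\eta(x)$ for every $a\colon x\to y$ in $G_1$, and moreover $\eta(x_1+x_2)=\eta(x_1)+\eta(x_2)$ for all $x_1,x_2\in G_0$. Vertical composition of $\eta\colon f\Rightarrow g$ and $\zeta\colon g\Rightarrow h$ is $(\zeta\circ_v\eta)(x)=\zeta(x)\circ\eta(x)$, giving $\zeta\circ_v\eta\colon f\Rightarrow h$. Horizontal composition of $\eta\colon f\Rightarrow g$ and $\eta'\colon f'\Rightarrow g'$ is $\eta'\circ_h\eta\colon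 f'f\Rightarrow g'g$, $(\eta'\circ_h\eta)(x)=\eta'(g(x))\circ f'(\eta(x))$. $\operatorname{Nat}(\mathbb{G})$ is a monoid under $\circ_h$ with identity $1_{1_{\mathbb{G}}}$ (the identity natural transformation of the identity functor). An element of $\operatorname{Nat}(\mathbb{G})$ is regular if it is invertible with respect to $\circ_h$; $\mathcal{W}(\mathbb{G})$ is the group of regular elements under $\circ_h$. *)

theory Defs
  imports "HOL-Algebra.Group"
begin

text \<open>
  The groups of a group-groupoid are HOL-Algebra groups, so their operation (additive in the
  usual notation for group-groupoids) is written multiplicatively. As usual in HOL-Algebra, all
  structure maps are total functions that matter only on the carriers; \<open>cmp G b a\<close> is the
  composite of \<open>b\<close> after \<open>a\<close> and matters only if \<open>src G b = tgt G a\<close>.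
\<close>

record ('m, 'o) ggpd =
  Mor :: "'m monoid"
  Obj :: "'o monoid"
  src :: "'m \<Rightarrow> 'o"
  tgt :: "'m \<Rightarrow> 'o"
  idn :: "'o \<Rightarrow> 'm"
  cmp :: "'m \<Rightarrow> 'm \<Rightarrow> 'm"

definition composable :: "('m, 'o) ggpd \<Rightarrow> ('m \<times> 'm) monoid" where
  "composable G = (Mor G \<times>\<times> Mor G)
     \<lparr>carrier := {(b, a). b \<in> carrier (Mor G) \<and> a \<in> carrier (Mor G) \<and> src G b = tgt G a}\<rparr>"

locale group_groupoid =
  fixes G :: "('m, 'o) ggpd"
  assumes group_Mor: "group (Mor G)"
    and group_Obj: "group (Obj G)"
    and src_hom: "src G \<in> hom (Mor G) (Obj G)"
    and tgt_hom: "tgt G \<in> hom (Mor G) (Obj G)"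
    and idn_hom: "idn G \<in> hom (Obj G) (Mor G)"
    and cmp_hom: "(\<lambda>(b, a). cmp G b a) \<in> hom (composable G) (Mor G)"
    and src_idn: "x \<in> carrier (Obj G) \<Longrightarrow> src G (idn G x) = x"
    and tgt_idn: "x \<in> carrier (Obj G) \<Longrightarrow> tgt G (idn G x) = x"
    and src_cmp: "\<lbrakk>a \<in> carrier (Mor G); b \<in> carrier (Mor G); src G b = tgt G a\<rbrakk>
      \<Longrightarrow> src G (cmp G b a) = src G a"
    and tgt_cmp: "\<lbrakk>a \<in> carrier (Mor G); b \<in> carrier (Mor G); src G b = tgt G a\<rbrakk>
      \<Longrightarrow> tgt G (cmp G b a) = tgt G b"
    and cmp_assoc: "\<lbrakk>a \<in> carrier (Mor G); b \<in> carrier (Mor G); c \<in> carrier (Mor G);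
        src G b = tgt G a; src G c = tgt G b\<rbrakk>
      \<Longrightarrow> cmp G c (cmp G b a) = cmp G (cmp G c b) a"
    and cmp_idn_right: "a \<in> carrier (Mor G) \<Longrightarrow> cmp G a (idn G (src G a)) = a"
    and cmp_idn_left: "a \<in> carrier (Mor G) \<Longrightarrow> cmp G (idn G (tgt G a)) a = a"
    and cmp_inverse: "a \<in> carrier (Mor G) \<Longrightarrow>
      \<exists>b \<in> carrier (Mor G). src G b = tgt G a \<and> tgt G b = src G a \<and>
        cmp G b a = idn G (src G a) \<and> cmp G a b = idn G (tgt G a)"

text \<open>
  A morphism is a pair \<open>(f\<^sub>1, f\<^sub>0)\<close>. Its components are required to be \<^const>\<open>extensional\<close>, so that
  HOL equality of pairs is equality of morphisms.
\<close>

type_synonym ('m, 'o) ggpd_endo = "('m \<Rightarrow> 'm) \<times> ('o \<Rightarrow> 'o)"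

definition ggpd_end :: "('m, 'o) ggpd \<Rightarrow> ('m, 'o) ggpd_endo set" where
  "ggpd_end G = {(f1, f0).
     f1 \<in> hom (Mor G) (Mor G) \<and> f1 \<in> extensional (carrier (Mor G)) \<and>
     f0 \<in> hom (Obj G) (Obj G) \<and> f0 \<in> extensional (carrier (Obj G)) \<and>
     (\<forall>a \<in> carrier (Mor G). src G (f1 a) = f0 (src G a) \<and> tgt G (f1 a) = f0 (tgt G a)) \<and>
     (\<forall>x \<in> carrier (Obj G). f1 (idn G x) = idn G (f0 x)) \<and>
     (\<forall>a \<in> carrier (Mor G). \<forall>b \<in> carrier (Mor G). src G b = tgt G a \<longrightarrow>
        f1 (cmp G b a) = cmp G (f1 b) (f1 a))}"

definition end_comp ::
  "('m, 'o) ggpd \<Rightarrow> ('m, 'o) ggpd_endo \<Rightarrow> ('m, 'o) ggpd_endo \<Rightarrow> ('m, 'o) ggpd_endo" where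
  "end_comp G f' f =
     (compose (carrier (Mor G)) (fst f') (fst f), compose (carrier (Obj G)) (snd f') (snd f))"

definition end_id :: "('m, 'o) ggpd \<Rightarrow> ('m, 'o) ggpd_endo" where
  "end_id G = ((\<lambda>a \<in> carrier (Mor G). a), (\<lambda>x \<in> carrier (Obj G). x))"

definition AutG :: "('m, 'o) ggpd \<Rightarrow> ('m, 'o) ggpd_endo monoid" where
  "AutG G =
     \<lparr>carrier = {f \<in> ggpd_end G. fst f \<in> iso (Mor G) (Mor G) \<and> snd f \<in> iso (Obj G) (Obj G)},
      mult = end_comp G, one = end_id G\<rparr>"

text \<open>
  Source and target functor are part of a natural transformation; the family of components is
  \<^const>\<open>extensional\<close> on the objects, for the same reason as above.
\<close>

datatype ('m, 'o) nat_trans =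
  NatTrans (nt_src: "('m, 'o) ggpd_endo") (nt_app: "'o \<Rightarrow> 'm") (nt_tgt: "('m, 'o) ggpd_endo")

definition nat_transs :: "('m, 'o) ggpd \<Rightarrow> ('m, 'o) nat_trans set" where
  "nat_transs G = {NatTrans f \<eta> g | f \<eta> g.
     f \<in> ggpd_end G \<and> g \<in> ggpd_end G \<and>
     \<eta> \<in> hom (Obj G) (Mor G) \<and> \<eta> \<in> extensional (carrier (Obj G)) \<and>
     (\<forall>x \<in> carrier (Obj G). src G (\<eta> x) = snd f x \<and> tgt G (\<eta> x) = snd g x) \<and>
     (\<forall>a \<in> carrier (Mor G). cmp G (\<eta> (tgt G a)) (fst f a) = cmp G (fst g a) (\<eta> (src G a)))}"

definition nt_id :: "('m, 'o) ggpd \<Rightarrow> ('m, 'o) ggpd_endo \<Rightarrow> ('m, 'o) nat_trans" where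
  "nt_id G f = NatTrans f (\<lambda>x \<in> carrier (Obj G). idn G (snd f x)) f"

definition vcomp ::
  "('m, 'o) ggpd \<Rightarrow> ('m, 'o) nat_trans \<Rightarrow> ('m, 'o) nat_trans \<Rightarrow> ('m, 'o) nat_trans" where
  "vcomp G \<zeta> \<eta> =
     NatTrans (nt_src \<eta>) (\<lambda>x \<in> carrier (Obj G). cmp G (nt_app \<zeta> x) (nt_app \<eta> x)) (nt_tgt \<zeta>)"

definition hcomp ::
  "('m, 'o) ggpd \<Rightarrow> ('m, 'o) nat_trans \<Rightarrow> ('m, 'o) nat_trans \<Rightarrow> ('m, 'o) nat_trans" where
  "hcomp G \<eta>' \<eta> =
     NatTrans (end_comp G (nt_src \<eta>') (nt_src \<eta>))
       (\<lambda>x \<in> carrier (Obj G).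
          cmp G (nt_app \<eta>' (snd (nt_tgt \<eta>) x)) (fst (nt_src \<eta>') (nt_app \<eta> x)))
       (end_comp G (nt_tgt \<eta>') (nt_tgt \<eta>))"

definition NatG :: "('m, 'o) ggpd \<Rightarrow> ('m, 'o) nat_trans monoid" where
  "NatG G = \<lparr>carrier = nat_transs G, mult = hcomp G, one = nt_id G (end_id G)\<rparr>"

definition WG :: "('m, 'o) ggpd \<Rightarrow> ('m, 'o) nat_trans monoid" where
  "WG G = units_of (NatG G)"

end

theory Submission
  imports Defs
begin

text \<open>
  Horizontal composition makes the natural transformations a monoid, and vertical composition is
  compatible with it by the interchange law. Hence the vertical composite of two regular
  transformations is regular, with the vertical composite of the horizontal inverses as horizontal
  inverse. The same argument applies to vertical inverses, which exist pointwise and are additive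
  because inversion in a group-groupoid is a homomorphism.
\<close>

section \<open>Membership criteria and projections\<close>

lemma ggpd_end_iff:
  "f \<in> ggpd_end G \<longleftrightarrow>
     fst f \<in> hom (Mor G) (Mor G) \<and> fst f \<in> extensional (carrier (Mor G)) \<and>
     snd f \<in> hom (Obj G) (Obj G) \<and> snd f \<in> extensional (carrier (Obj G)) \<and>
     (\<forall>a \<in> carrier (Mor G). src G (fst f a) = snd f (src G a) \<and> tgt G (fst f a) = snd f (tgt G a)) \<and>
     (\<forall>x \<in> carrier (Obj G). fst f (idn G x) = idn G (snd f x)) \<and>
     (\<forall>a \<in> carrier (Mor G). \<forall>b \<in> carrier (Mor G). src G b = tgt G a \<longrightarrow>
        fst f (cmp G b a) = cmp G (fst f b) (fst f a))"
  unfolding ggpd_end_def by (cases f) simp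

lemma nat_transs_iff:
  "t \<in> nat_transs G \<longleftrightarrow>
     nt_src t \<in> ggpd_end G \<and> nt_tgt t \<in> ggpd_end G \<and>
     nt_app t \<in> hom (Obj G) (Mor G) \<and> nt_app t \<in> extensional (carrier (Obj G)) \<and>
     (\<forall>x \<in> carrier (Obj G).
        src G (nt_app t x) = snd (nt_src t) x \<and> tgt G (nt_app t x) = snd (nt_tgt t) x) \<and>
     (\<forall>a \<in> carrier (Mor G). cmp G (nt_app t (tgt G a)) (fst (nt_src t) a)
        = cmp G (fst (nt_tgt t) a) (nt_app t (src G a)))"
  unfolding nat_transs_def by (cases t) (auto simp: split_paired_Ex)

lemma NatG_simps [simp]:
  "carrier (NatG G) = nat_transs G" "mult (NatG G) = hcomp G" "one (NatG G) = nt_id G (end_id G)"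
  by (simp_all add: NatG_def)

text \<open>Auxiliary monoid of all endomorphisms: its unit group turns out to be
  \<open>AutG G\<close>, just as \<open>WG G\<close> is the unit group of
  \<open>NatG G\<close>.\<close>

definition EndG :: "('m, 'o) ggpd \<Rightarrow> ('m, 'o) ggpd_endo monoid" where
  "EndG G = \<lparr>carrier = ggpd_end G, mult = end_comp G, one = end_id G\<rparr>"

lemma EndG_simps [simp]:
  "carrier (EndG G) = ggpd_end G" "mult (EndG G) = end_comp G" "one (EndG G) = end_id G"
  by (simp_all add: EndG_def)

lemma nt_src_simps [simp]:
  "nt_src (nt_id G f) = f" "nt_src (vcomp G s t) = nt_src t"
  "nt_src (hcomp G s t) = end_comp G (nt_src s) (nt_src t)"
  by (simp_all add: nt_id_def vcomp_def hcomp_def)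

lemma nt_tgt_simps [simp]:
  "nt_tgt (nt_id G f) = f" "nt_tgt (vcomp G s t) = nt_tgt s"
  "nt_tgt (hcomp G s t) = end_comp G (nt_tgt s) (nt_tgt t)"
  by (simp_all add: nt_id_def vcomp_def hcomp_def)

lemma nt_app_simps:
  "nt_app (nt_id G f) = (\<lambda>x \<in> carrier (Obj G). idn G (snd f x))"
  "nt_app (vcomp G s t) = (\<lambda>x \<in> carrier (Obj G). cmp G (nt_app s x) (nt_app t x))"
  "nt_app (hcomp G s t) = (\<lambda>x \<in> carrier (Obj G).
     cmp G (nt_app s (snd (nt_tgt t) x)) (fst (nt_src s) (nt_app t x)))"
  by (simp_all add: nt_id_def vcomp_def hcomp_def)

section \<open>Calculus of morphisms in a group-groupoid\<close>

context group_groupoid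
begin

abbreviation (input) M where "M \<equiv> carrier (Mor G)"
abbreviation (input) Ob where "Ob \<equiv> carrier (Obj G)"

lemma src_closed [simp]: "a \<in> M \<Longrightarrow> src G a \<in> Ob"
  and tgt_closed [simp]: "a \<in> M \<Longrightarrow> tgt G a \<in> Ob"
  and idn_closed [simp]: "x \<in> Ob \<Longrightarrow> idn G x \<in> M"
  using src_hom tgt_hom idn_hom by (auto simp: hom_def)

lemma src_mult: "a \<in> M \<Longrightarrow> b \<in> M \<Longrightarrow> src G (a \<otimes>\<^bsub>Mor G\<^esub> b) = src G a \<otimes>\<^bsub>Obj G\<^esub> src G b"
  and tgt_mult: "a \<in> M \<Longrightarrow> b \<in> M \<Longrightarrow> tgt G (a \<otimes>\<^bsub>Mor G\<^esub> b) = tgt G a \<otimes>\<^bsub>Obj G\<^esub> tgt G b"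
  and idn_mult: "x \<in> Ob \<Longrightarrow> y \<in> Ob \<Longrightarrow> idn G (x \<otimes>\<^bsub>Obj G\<^esub> y) = idn G x \<otimes>\<^bsub>Mor G\<^esub> idn G y"
  using src_hom tgt_hom idn_hom by (auto simp: hom_def)

lemma mult_closed [simp]:
  "a \<in> M \<Longrightarrow> b \<in> M \<Longrightarrow> a \<otimes>\<^bsub>Mor G\<^esub> b \<in> M"
  "x \<in> Ob \<Longrightarrow> y \<in> Ob \<Longrightarrow> x \<otimes>\<^bsub>Obj G\<^esub> y \<in> Ob"
  using monoid.m_closed[OF group.is_monoid[OF group_Mor]]
    monoid.m_closed[OF group.is_monoid[OF group_Obj]] by blast+

lemma cmp_closed [simp]:
  "\<lbrakk>a \<in> M; b \<in> M; src G b = tgt G a\<rbrakk> \<Longrightarrow> cmp G b a \<in> M"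
  using hom_in_carrier[OF cmp_hom, of "(b, a)"] by (simp add: composable_def)

text \<open>The homomorphism property of composition on the pullback, unfolded. It makes pointwise
  inverses and both kinds of composites additive.\<close>

lemma cmp_mult:
  assumes "a \<in> M" "b \<in> M" "src G b = tgt G a" "a' \<in> M" "b' \<in> M" "src G b' = tgt G a'"
  shows "cmp G (b \<otimes>\<^bsub>Mor G\<^esub> b') (a \<otimes>\<^bsub>Mor G\<^esub> a') = cmp G b a \<otimes>\<^bsub>Mor G\<^esub> cmp G b' a'"
proof -
  have "(b, a) \<in> carrier (composable G)" "(b', a') \<in> carrier (composable G)"
    using assms by (auto simp: composable_def)
  from hom_mult[OF cmp_hom this] show ?thesis
    by (simp add: composable_def DirProd_def)
qed

lemmas groupoid_simps = src_idn tgt_idn src_cmp tgt_cmp cmp_idn_right cmp_idn_left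

text \<open>The axioms only assert that an inverse exists, so one is chosen;
  \<open>mor_inv_unique\<close> shows the choice to be immaterial.\<close>

definition mor_inv :: "'m \<Rightarrow> 'm" where
  "mor_inv a = (SOME b. b \<in> M \<and> src G b = tgt G a \<and> tgt G b = src G a \<and>
     cmp G b a = idn G (src G a) \<and> cmp G a b = idn G (tgt G a))"

lemma mor_inv:
  assumes "a \<in> M"
  shows mor_inv_closed: "mor_inv a \<in> M"
    and src_mor_inv: "src G (mor_inv a) = tgt G a"
    and tgt_mor_inv: "tgt G (mor_inv a) = src G a"
    and cmp_mor_inv_left: "cmp G (mor_inv a) a = idn G (src G a)"
    and cmp_mor_inv_right: "cmp G a (mor_inv a) = idn G (tgt G a)"
proof -
  have "\<exists>b. b \<in> M \<and> src G b = tgt G a \<and> tgt G b = src G a \<and>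
     cmp G b a = idn G (src G a) \<and> cmp G a b = idn G (tgt G a)"
    using cmp_inverse[OF assms] by auto
  from someI_ex[OF this, folded mor_inv_def]
  show "mor_inv a \<in> M" "src G (mor_inv a) = tgt G a" "tgt G (mor_inv a) = src G a"
    "cmp G (mor_inv a) a = idn G (src G a)" "cmp G a (mor_inv a) = idn G (tgt G a)"
    by auto
qed

text \<open>Composing \<open>b\<close> with the identity \<open>cmp G a (mor_inv a)\<close> on the
  right and reassociating cancels \<open>b\<close> against \<open>a\<close>.\<close>

lemma mor_inv_unique:
  assumes "a \<in> M" "b \<in> M" "src G b = tgt G a" "tgt G b = src G a"
    and left: "cmp G b a = idn G (src G a)"
  shows "b = mor_inv a"
proof -
  have "b = cmp G b (cmp G a (mor_inv a))"
    using assms by (metis cmp_mor_inv_right cmp_idn_right)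
  also have "\<dots> = cmp G (cmp G b a) (mor_inv a)"
    using assms by (intro cmp_assoc) (simp_all add: mor_inv)
  also have "\<dots> = mor_inv a"
    using assms by (metis left cmp_idn_left mor_inv_closed tgt_mor_inv)
  finally show ?thesis .
qed

text \<open>By \<open>cmp_mult\<close> the product of the inverses is a left inverse of the product,
  and uniqueness identifies it. Additivity of vertical inverses rests on this.\<close>

lemma mor_inv_mult:
  assumes "a \<in> M" "b \<in> M"
  shows "mor_inv (a \<otimes>\<^bsub>Mor G\<^esub> b) = mor_inv a \<otimes>\<^bsub>Mor G\<^esub> mor_inv b"
  using assms
  by (intro mor_inv_unique[symmetric]) (simp_all add: mor_inv src_mult tgt_mult cmp_mult idn_mult)

section \<open>Endomorphisms and automorphisms\<close>

lemma end_closed [simp]: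
  "f \<in> ggpd_end G \<Longrightarrow> a \<in> M \<Longrightarrow> fst f a \<in> M"
  "f \<in> ggpd_end G \<Longrightarrow> x \<in> Ob \<Longrightarrow> snd f x \<in> Ob"
  by (auto simp: ggpd_end_iff hom_def)

lemma end_simps:
  assumes "f \<in> ggpd_end G"
  shows "a \<in> M \<Longrightarrow> b \<in> M \<Longrightarrow> fst f (a \<otimes>\<^bsub>Mor G\<^esub> b) = fst f a \<otimes>\<^bsub>Mor G\<^esub> fst f b"
    and "x \<in> Ob \<Longrightarrow> y \<in> Ob \<Longrightarrow> snd f (x \<otimes>\<^bsub>Obj G\<^esub> y) = snd f x \<otimes>\<^bsub>Obj G\<^esub> snd f y"
    and "a \<in> M \<Longrightarrow> src G (fst f a) = snd f (src G a)"
    and "a \<in> M \<Longrightarrow> tgt G (fst f a) = snd f (tgt G a)"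
    and "x \<in> Ob \<Longrightarrow> fst f (idn G x) = idn G (snd f x)"
    and "\<lbrakk>a \<in> M; b \<in> M; src G b = tgt G a\<rbrakk> \<Longrightarrow>
      fst f (cmp G b a) = cmp G (fst f b) (fst f a)"
  using assms unfolding ggpd_end_iff hom_def by blast+

lemma end_ext:
  assumes "f \<in> ggpd_end G" "g \<in> ggpd_end G"
    and "\<And>a. a \<in> M \<Longrightarrow> fst f a = fst g a" "\<And>x. x \<in> Ob \<Longrightarrow> snd f x = snd g x"
  shows "f = g"
  using assms by (intro prod_eqI) (auto simp: ggpd_end_iff intro: extensionalityI)

lemma end_comp_app [simp]:
  "a \<in> M \<Longrightarrow> fst (end_comp G g f) a = fst g (fst f a)"
  "x \<in> Ob \<Longrightarrow> snd (end_comp G g f) x = snd g (snd f x)"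
  by (simp_all add: end_comp_def compose_eq)

lemma end_id_app [simp]:
  "a \<in> M \<Longrightarrow> fst (end_id G) a = a"
  "x \<in> Ob \<Longrightarrow> snd (end_id G) x = x"
  by (simp_all add: end_id_def)

lemma end_comp_closed [simp]:
  assumes "f \<in> ggpd_end G" "g \<in> ggpd_end G"
  shows "end_comp G g f \<in> ggpd_end G"
proof -
  have "fst (end_comp G g f) \<in> extensional M" "snd (end_comp G g f) \<in> extensional Ob"
    by (simp_all add: end_comp_def)
  then show ?thesis
    unfolding ggpd_end_iff hom_def using assms by (auto simp: end_simps)
qed

lemma end_id_closed [simp]: "end_id G \<in> ggpd_end G"
proof -
  have "fst (end_id G) \<in> extensional M" "snd (end_id G) \<in> extensional Ob"
    by (simp_all add: end_id_def)
  then show ?thesis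
    unfolding ggpd_end_iff hom_def by auto
qed

lemma end_comp_id [simp]:
  assumes "f \<in> ggpd_end G"
  shows "end_comp G f (end_id G) = f" "end_comp G (end_id G) f = f"
  using assms by (auto intro!: end_ext)

lemma monoid_EndG: "monoid (EndG G)"
  by (rule monoidI) (simp_all, intro end_ext, simp_all)

text \<open>Each law for the setwise inverse is obtained by applying \<open>f\<close> to both sides
  and cancelling by injectivity.\<close>

lemma end_inv:
  assumes f: "f \<in> ggpd_end G" and bij: "bij_betw (fst f) M M" "bij_betw (snd f) Ob Ob"
  obtains g where "g \<in> ggpd_end G" "end_comp G g f = end_id G" "end_comp G f g = end_id G"
proof -
  \<comment> \<open>Restricting \<open>inv_into\<close> to the carriers makes both components
    extensional, as \<open>ggpd_end\<close> demands.\<close>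
  define g where "g = ((\<lambda>a \<in> M. inv_into M (fst f) a), (\<lambda>x \<in> Ob. inv_into Ob (snd f) x))"
  have inj: "a = b" if "fst f a = fst f b" "a \<in> M" "b \<in> M" for a b
    using bij(1) that by (auto simp: bij_betw_def dest: inj_onD)
  have inj': "x = y" if "snd f x = snd f y" "x \<in> Ob" "y \<in> Ob" for x y
    using bij(2) that by (auto simp: bij_betw_def dest: inj_onD)
  have closed: "fst g a \<in> M" "fst f (fst g a) = a" if "a \<in> M" for a
    using that bij(1) by (auto simp: g_def bij_betw_def f_inv_into_f inv_into_into)
  have closed': "snd g x \<in> Ob" "snd f (snd g x) = x" if "x \<in> Ob" for x
    using that bij(2) by (auto simp: g_def bij_betw_def f_inv_into_f inv_into_into)
  note c = closed closed'
  \<comment> \<open>Endpoints come first: \<open>fst g b\<close> and \<open>fst g a\<close> must be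
    known to be composable before \<open>f\<close> can be distributed over their composite.\<close>
  have src_tgt: "src G (fst g a) = snd g (src G a)" "tgt G (fst g a) = snd g (tgt G a)"
    if a: "a \<in> M" for a
  proof -
    have "snd f (src G (fst g a)) = src G a" "snd f (tgt G (fst g a)) = tgt G a"
      using a end_simps(3,4)[OF f, of "fst g a"] by (simp_all add: c)
    with a show "src G (fst g a) = snd g (src G a)" "tgt G (fst g a) = snd g (tgt G a)"
      by (auto intro: inj' simp: c)
  qed
  have "fst g (a \<otimes>\<^bsub>Mor G\<^esub> b) = fst g a \<otimes>\<^bsub>Mor G\<^esub> fst g b" if "a \<in> M" "b \<in> M" for a b
    by (rule inj) (use f that in \<open>simp_all add: c end_simps\<close>)
  moreover have "snd g (x \<otimes>\<^bsub>Obj G\<^esub> y) = snd g x \<otimes>\<^bsub>Obj G\<^esub> snd g y"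
    if "x \<in> Ob" "y \<in> Ob" for x y
    by (rule inj') (use f that in \<open>simp_all add: c end_simps\<close>)
  moreover have "fst g (idn G x) = idn G (snd g x)" if "x \<in> Ob" for x
    by (rule inj) (use f that in \<open>simp_all add: c end_simps\<close>)
  moreover have "fst g (cmp G b a) = cmp G (fst g b) (fst g a)"
    if "a \<in> M" "b \<in> M" "src G b = tgt G a" for a b
    by (rule inj) (use f that in \<open>simp_all add: c src_tgt end_simps\<close>)
  moreover have "fst g \<in> extensional M" "snd g \<in> extensional Ob"
    by (simp_all add: g_def)
  ultimately have g: "g \<in> ggpd_end G"
    unfolding ggpd_end_iff hom_def by (simp add: c src_tgt)
  have "fst g (fst f a) = a" if "a \<in> M" for a
    by (rule inj) (use f that in \<open>simp_all add: c\<close>)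
  moreover have "snd g (snd f x) = x" if "x \<in> Ob" for x
    by (rule inj') (use f that in \<open>simp_all add: c\<close>)
  ultimately show thesis
    using f g by (intro that[OF g] end_ext) (simp_all add: c)
qed

text \<open>Lets the general fact that the units of a monoid form a group supply the group
  structure. The substantial direction is \<open>end_inv\<close>: bijective components already yield
  an inverse morphism.\<close>

lemma AutG_eq: "AutG G = units_of (EndG G)"
proof -
  have "f \<in> Units (EndG G) \<longleftrightarrow>
      f \<in> ggpd_end G \<and> fst f \<in> iso (Mor G) (Mor G) \<and> snd f \<in> iso (Obj G) (Obj G)" for f
  proof
    assume "f \<in> Units (EndG G)"
    then obtain g where f: "f \<in> ggpd_end G" and g: "g \<in> ggpd_end G"
      and eq: "end_comp G g f = end_id G" "end_comp G f g = end_id G"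
      by (auto simp: Units_def)
    \<comment> \<open>By \<open>eq\<close> the components of \<open>g\<close> invert those of
      \<open>f\<close>; \<open>end_comp_app\<close> is read backwards so that these equations
      match.\<close>
    have "bij_betw (fst f) M M"
      using f g eq
      by (intro bij_betw_byWitness[where f' = "fst g"])
        (auto simp flip: end_comp_app(1))
    moreover have "bij_betw (snd f) Ob Ob"
      using f g eq
      by (intro bij_betw_byWitness[where f' = "snd g"])
        (auto simp flip: end_comp_app(2))
    ultimately show "f \<in> ggpd_end G \<and> fst f \<in> iso (Mor G) (Mor G) \<and> snd f \<in> iso (Obj G) (Obj G)"
      using f by (auto simp: iso_def ggpd_end_iff)
  next
    assume f: "f \<in> ggpd_end G \<and> fst f \<in> iso (Mor G) (Mor G) \<and> snd f \<in> iso (Obj G) (Obj G)"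
    then obtain g where "g \<in> ggpd_end G" "end_comp G g f = end_id G" "end_comp G f g = end_id G"
      using end_inv[of f] by (auto simp: iso_def)
    with f show "f \<in> Units (EndG G)"
      by (auto simp: Units_def)
  qed
  then show ?thesis
    by (auto simp: AutG_def units_of_def)
qed

section \<open>Natural transformations and their horizontal and vertical composition\<close>

lemma nt_end [simp]:
  "t \<in> nat_transs G \<Longrightarrow> nt_src t \<in> ggpd_end G"
  "t \<in> nat_transs G \<Longrightarrow> nt_tgt t \<in> ggpd_end G"
  by (simp_all add: nat_transs_iff)

lemma nt_app_closed [simp]: "t \<in> nat_transs G \<Longrightarrow> x \<in> Ob \<Longrightarrow> nt_app t x \<in> M"
  unfolding nat_transs_iff hom_def by blast

lemma nt_app:
  assumes "t \<in> nat_transs G"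
  shows "x \<in> Ob \<Longrightarrow> src G (nt_app t x) = snd (nt_src t) x"
    and "x \<in> Ob \<Longrightarrow> tgt G (nt_app t x) = snd (nt_tgt t) x"
    and "x \<in> Ob \<Longrightarrow> y \<in> Ob \<Longrightarrow> nt_app t (x \<otimes>\<^bsub>Obj G\<^esub> y) = nt_app t x \<otimes>\<^bsub>Mor G\<^esub> nt_app t y"
  using assms unfolding nat_transs_iff hom_def by blast+

lemma nt_natural:
  "t \<in> nat_transs G \<Longrightarrow> a \<in> M \<Longrightarrow>
     cmp G (nt_app t (tgt G a)) (fst (nt_src t) a) = cmp G (fst (nt_tgt t) a) (nt_app t (src G a))"
  unfolding nat_transs_iff by blast

lemma nt_ext:
  assumes "s \<in> nat_transs G" "t \<in> nat_transs G" "nt_src s = nt_src t" "nt_tgt s = nt_tgt t"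
    and "\<And>x. x \<in> Ob \<Longrightarrow> nt_app s x = nt_app t x"
  shows "s = t"
proof -
  have "nt_app s \<in> extensional Ob" "nt_app t \<in> extensional Ob"
    using assms(1,2) unfolding nat_transs_iff by blast+
  then have "nt_app s = nt_app t"
    using assms(5) by (rule extensionalityI)
  then show ?thesis
    using assms(3,4) by (intro nat_trans.expand) simp
qed

text \<open>Both sides of the naturality square at \<open>a\<close> collapse to
  \<open>fst f a\<close> by the unit laws.\<close>

lemma nt_id_closed [simp]: "f \<in> ggpd_end G \<Longrightarrow> nt_id G f \<in> nat_transs G"
  unfolding nat_transs_iff[of "nt_id G f"] hom_def
  by (auto simp: nt_app_simps groupoid_simps end_simps idn_mult)
    (metis cmp_idn_left cmp_idn_right end_closed(1) end_simps(3,4))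

text \<open>The naturality squares of \<open>t\<close> and \<open>s\<close> are pasted along their
  common functor; additivity comes from \<open>cmp_mult\<close>.\<close>

lemma vcomp_closed [simp]:
  assumes s: "s \<in> nat_transs G" and t: "t \<in> nat_transs G" and st: "nt_src s = nt_tgt t"
  shows "vcomp G s t \<in> nat_transs G"
proof -
  have "cmp G (cmp G (nt_app s (tgt G a)) (nt_app t (tgt G a))) (fst (nt_src t) a) =
      cmp G (fst (nt_tgt s) a) (cmp G (nt_app s (src G a)) (nt_app t (src G a)))"
    if a: "a \<in> M" for a
  proof -
    have "cmp G (cmp G (nt_app s (tgt G a)) (nt_app t (tgt G a))) (fst (nt_src t) a)
        = cmp G (nt_app s (tgt G a)) (cmp G (fst (nt_src s) a) (nt_app t (src G a)))"
      using s t a st by (simp add: cmp_assoc[symmetric] nt_app end_simps nt_natural)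
    also have "\<dots> = cmp G (cmp G (nt_app s (tgt G a)) (fst (nt_src s) a)) (nt_app t (src G a))"
      using s t a st by (intro cmp_assoc) (simp_all add: nt_app end_simps)
    also have "\<dots> = cmp G (fst (nt_tgt s) a) (cmp G (nt_app s (src G a)) (nt_app t (src G a)))"
      using s t a st nt_natural[OF s a] by (simp add: cmp_assoc nt_app end_simps)
    finally show ?thesis .
  qed
  then show ?thesis
    unfolding nat_transs_iff[of "vcomp G s t"] hom_def using s t st
    by (auto simp: nt_app_simps groupoid_simps nt_app cmp_mult)
qed

text \<open>Naturality pastes two squares: the image of the square of \<open>t\<close> at
  \<open>a\<close> under the source functor of \<open>s\<close>, and the square of \<open>s\<close>
  at the morphism \<open>fst (nt_tgt t) a\<close>.\<close>

lemma hcomp_closed [simp]: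
  assumes s: "s \<in> nat_transs G" and t: "t \<in> nat_transs G"
  shows "hcomp G s t \<in> nat_transs G"
proof -
  let ?f = "fst (nt_src t)" and ?g = "fst (nt_tgt t)" and ?f' = "fst (nt_src s)"
    and ?g' = "fst (nt_tgt s)" and ?h = "snd (nt_tgt t)"
  have "cmp G (cmp G (nt_app s (?h (tgt G a))) (?f' (nt_app t (tgt G a)))) (?f' (?f a)) =
      cmp G (?g' (?g a)) (cmp G (nt_app s (?h (src G a))) (?f' (nt_app t (src G a))))"
    if a: "a \<in> M" for a
  proof -
    have "cmp G (cmp G (nt_app s (?h (tgt G a))) (?f' (nt_app t (tgt G a)))) (?f' (?f a))
        = cmp G (nt_app s (?h (tgt G a))) (?f' (cmp G (nt_app t (tgt G a)) (?f a)))"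
      using s t a by (simp add: cmp_assoc[symmetric] nt_app end_simps)
    also have "\<dots> = cmp G (nt_app s (?h (tgt G a))) (cmp G (?f' (?g a)) (?f' (nt_app t (src G a))))"
      using s t a by (simp add: nt_natural) (simp add: nt_app end_simps)
    \<comment> \<open>The object is rewritten as an endpoint of \<open>?g a\<close>, so that
      naturality of \<open>s\<close> at that morphism applies.\<close>
    also have "\<dots> = cmp G (cmp G (nt_app s (tgt G (?g a))) (?f' (?g a))) (?f' (nt_app t (src G a)))"
      using s t a by (simp add: cmp_assoc nt_app end_simps)
    also have "\<dots> = cmp G (cmp G (?g' (?g a)) (nt_app s (src G (?g a)))) (?f' (nt_app t (src G a)))"
      using s t a by (subst nt_natural) auto
    also have "\<dots> = cmp G (?g' (?g a)) (cmp G (nt_app s (?h (src G a))) (?f' (nt_app t (src G a))))"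
      using s t a by (simp add: cmp_assoc nt_app end_simps)
    finally show ?thesis .
  qed
  then show ?thesis
    unfolding nat_transs_iff[of "hcomp G s t"] hom_def using s t
    by (auto simp: nt_app_simps groupoid_simps nt_app end_simps cmp_mult)
qed

lemma end_comp_assoc:
  "f \<in> ggpd_end G \<Longrightarrow> g \<in> ggpd_end G \<Longrightarrow> h \<in> ggpd_end G \<Longrightarrow>
     end_comp G (end_comp G h g) f = end_comp G h (end_comp G g f)"
  using monoid.m_assoc[OF monoid_EndG] by simp

lemma monoid_NatG: "monoid (NatG G)"
proof (rule monoidI; unfold NatG_simps)
  \<comment> \<open>On components, both sides become the same triple composite once the source
    functor of \<open>s\<close> is distributed over a component of
    \<open>hcomp G t u\<close>.\<close>
  fix s t u assume stu: "s \<in> nat_transs G" "t \<in> nat_transs G" "u \<in> nat_transs G"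
  then show "hcomp G (hcomp G s t) u = hcomp G s (hcomp G t u)"
    by (intro nt_ext)
      (simp_all add: end_comp_assoc, simp add: nt_app_simps end_simps nt_app cmp_assoc)
next
  fix t assume t: "t \<in> nat_transs G"
  show "hcomp G (nt_id G (end_id G)) t = t"
    using t by (intro nt_ext; simp add: nt_app_simps) (metis cmp_idn_left nt_app(2) nt_app_closed)
  show "hcomp G t (nt_id G (end_id G)) = t"
    using t by (intro nt_ext; simp add: nt_app_simps end_simps)
      (metis cmp_idn_right nt_app(1) nt_app_closed)
qed auto

text \<open>Both sides are fourfold composites with the same outer factors, and naturality of
  \<open>t'\<close> exchanges the inner two. With horizontal composition as product, this is the
  homomorphism law for vertical composition.\<close>

lemma interchange:
  assumes t: "t \<in> nat_transs G" "s \<in> nat_transs G" "nt_src s = nt_tgt t"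
    and t': "t' \<in> nat_transs G" "s' \<in> nat_transs G" "nt_src s' = nt_tgt t'"
  shows "hcomp G (vcomp G s' t') (vcomp G s t) = vcomp G (hcomp G s' s) (hcomp G t' t)"
proof (rule nt_ext)
  fix x assume x: "x \<in> Ob"
  let ?b = "nt_app s' (snd (nt_tgt s) x)" and ?a = "nt_app t' (snd (nt_tgt s) x)"
  let ?d = "fst (nt_src t') (nt_app s x)" and ?c = "fst (nt_src t') (nt_app t x)"
  let ?d' = "fst (nt_tgt t') (nt_app s x)" and ?a' = "nt_app t' (snd (nt_tgt t) x)"
  \<comment> \<open>The square of \<open>t'\<close> is taken at the morphism
    \<open>nt_app s x\<close>, whose source is \<open>snd (nt_tgt t) x\<close> because
    \<open>s\<close> starts where \<open>t\<close> ends.\<close>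
  have nat: "cmp G ?a ?d = cmp G ?d' ?a'"
    using nt_natural[OF t'(1), of "nt_app s x"] t x by (simp add: nt_app)
  have "nt_app (hcomp G (vcomp G s' t') (vcomp G s t)) x = cmp G (cmp G ?b ?a) (cmp G ?d ?c)"
    using t t' x by (simp add: nt_app_simps end_simps nt_app)
  also have "\<dots> = cmp G ?b (cmp G (cmp G ?a ?d) ?c)"
    using t t' x by (simp add: cmp_assoc[symmetric] end_simps nt_app groupoid_simps)
  also have "\<dots> = cmp G (cmp G ?b ?d') (cmp G ?a' ?c)"
    unfolding nat using t t' x by (simp add: cmp_assoc[symmetric] end_simps nt_app groupoid_simps)
  also have "\<dots> = nt_app (vcomp G (hcomp G s' s) (hcomp G t' t)) x"
    using t t' x by (simp add: nt_app_simps)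
  finally show "nt_app (hcomp G (vcomp G s' t') (vcomp G s t)) x =
    nt_app (vcomp G (hcomp G s' s) (hcomp G t' t)) x" .
qed (use t t' in auto)

text \<open>Functors preserve identities, so each component composes two identities. This makes
  \<open>nt_id G\<close> multiplicative and supplies horizontal inverses of identity
  transformations.\<close>

lemma hcomp_nt_id:
  assumes "f \<in> ggpd_end G" "g \<in> ggpd_end G"
  shows "hcomp G (nt_id G g) (nt_id G f) = nt_id G (end_comp G g f)"
  using assms by (intro nt_ext; simp add: nt_app_simps end_simps)
    (metis cmp_idn_left end_closed(2) idn_closed tgt_idn)

lemma vcomp_nt_id_left: "t \<in> nat_transs G \<Longrightarrow> vcomp G (nt_id G (nt_tgt t)) t = t"
  by (intro nt_ext; simp add: nt_app_simps) (metis cmp_idn_left nt_app(2) nt_app_closed)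

lemma vcomp_nt_id_right: "t \<in> nat_transs G \<Longrightarrow> vcomp G t (nt_id G (nt_src t)) = t"
  by (intro nt_ext; simp add: nt_app_simps) (metis cmp_idn_right nt_app(1) nt_app_closed)

lemma vcomp_assoc:
  assumes "t \<in> nat_transs G" "s \<in> nat_transs G" "u \<in> nat_transs G"
    and "nt_src s = nt_tgt t" "nt_src u = nt_tgt s"
  shows "vcomp G u (vcomp G s t) = vcomp G (vcomp G u s) t"
  using assms by (intro nt_ext) (simp_all, simp add: nt_app_simps nt_app cmp_assoc)

section \<open>Vertical inverses\<close>

definition vinv :: "('m, 'o) nat_trans \<Rightarrow> ('m, 'o) nat_trans" where
  "vinv t = NatTrans (nt_tgt t) (\<lambda>x \<in> Ob. mor_inv (nt_app t x)) (nt_src t)"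

lemma vinv_simps [simp]:
  "nt_src (vinv t) = nt_tgt t" "nt_tgt (vinv t) = nt_src t"
  "x \<in> Ob \<Longrightarrow> nt_app (vinv t) x = mor_inv (nt_app t x)"
  by (simp_all add: vinv_def)

text \<open>The naturality square of \<open>t\<close> is composed with the inverse of its component
  at \<open>tgt G a\<close> on the left and at \<open>src G a\<close> on the right; additivity is
  \<open>mor_inv_mult\<close>.\<close>

lemma vinv_closed [simp]:
  assumes t: "t \<in> nat_transs G"
  shows "vinv t \<in> nat_transs G"
proof -
  have "cmp G (mor_inv (nt_app t (tgt G a))) (fst (nt_tgt t) a)
      = cmp G (fst (nt_src t) a) (mor_inv (nt_app t (src G a)))" if a: "a \<in> M" for a
  proof -
    let ?y = "nt_app t (tgt G a)" and ?x = "nt_app t (src G a)"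
    let ?f = "fst (nt_src t) a" and ?g = "fst (nt_tgt t) a"
    have st: "?x \<in> M" "?y \<in> M" "?f \<in> M" "?g \<in> M" "src G ?g = tgt G ?x" "src G ?y = tgt G ?f"
      "src G ?f = src G ?x" "tgt G ?g = tgt G ?y"
      using t a by (simp_all add: nt_app end_simps)
    have "cmp G (mor_inv ?y) ?g = cmp G (mor_inv ?y) (cmp G ?g (cmp G ?x (mor_inv ?x)))"
      using st by (metis cmp_mor_inv_right cmp_idn_right)
    also have "\<dots> = cmp G (mor_inv ?y) (cmp G (cmp G ?g ?x) (mor_inv ?x))"
      using st by (simp add: cmp_assoc mor_inv(1-3))
    also have "\<dots> = cmp G (mor_inv ?y) (cmp G (cmp G ?y ?f) (mor_inv ?x))"
      using nt_natural[OF t a] by simp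
    also have "\<dots> = cmp G (cmp G (mor_inv ?y) ?y) (cmp G ?f (mor_inv ?x))"
      using st by (simp add: cmp_assoc mor_inv(1-3) groupoid_simps)
    also have "\<dots> = cmp G ?f (mor_inv ?x)"
      using st cmp_idn_left[of "cmp G ?f (mor_inv ?x)"] by (simp add: mor_inv groupoid_simps)
    finally show ?thesis .
  qed
  moreover have "nt_app (vinv t) \<in> extensional Ob"
    by (simp add: vinv_def)
  ultimately show ?thesis
    unfolding nat_transs_iff[of "vinv t"] hom_def using t
    by (auto simp: mor_inv nt_app mor_inv_mult)
qed

lemma vcomp_vinv:
  assumes t: "t \<in> nat_transs G"
  shows "vcomp G (vinv t) t = nt_id G (nt_src t)" "vcomp G t (vinv t) = nt_id G (nt_tgt t)"
  using t by (auto intro!: nt_ext simp: nt_app_simps mor_inv nt_app)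

section \<open>Regular natural transformations\<close>

lemma carrier_WG: "carrier (WG G) = Units (NatG G)"
  by (simp add: WG_def units_of_def)

lemma mult_WG: "mult (WG G) = hcomp G"
  by (simp add: WG_def units_of_def)

lemma carrier_AutG: "carrier (AutG G) = Units (EndG G)"
  by (simp add: AutG_eq units_of_def)

lemma mult_AutG: "mult (AutG G) = end_comp G"
  by (simp add: AutG_eq units_of_def)

lemma Units_NatG_iff:
  "t \<in> Units (NatG G) \<longleftrightarrow> t \<in> nat_transs G \<and> (\<exists>t' \<in> nat_transs G.
     hcomp G t' t = nt_id G (end_id G) \<and> hcomp G t t' = nt_id G (end_id G))"
  by (auto simp: Units_def)

lemma Units_EndG_iff:
  "f \<in> Units (EndG G) \<longleftrightarrow> f \<in> ggpd_end G \<and> (\<exists>g \<in> ggpd_end G.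
     end_comp G g f = end_id G \<and> end_comp G f g = end_id G)"
  by (auto simp: Units_def)

text \<open>Source and target are part of the data, so one equation of transformations carries two
  equations of functors.\<close>

lemma hcomp_eq_nt_idD:
  assumes "hcomp G s t = nt_id G f"
  shows "end_comp G (nt_src s) (nt_src t) = f" "end_comp G (nt_tgt s) (nt_tgt t) = f"
  using arg_cong[OF assms, of nt_src] arg_cong[OF assms, of nt_tgt]
  by (simp_all only: nt_src_simps nt_tgt_simps)

text \<open>The source and target of a horizontal inverse \<open>t'\<close> invert those of
  \<open>t\<close>. Hence both structure maps take values in the automorphism group.\<close>

lemma nt_src_tgt_Units:
  assumes "t \<in> Units (NatG G)"
  shows "nt_src t \<in> Units (EndG G)" "nt_tgt t \<in> Units (EndG G)"
proof -
  obtain t' where t: "t \<in> nat_transs G" "t' \<in> nat_transs G"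
    "hcomp G t' t = nt_id G (end_id G)" "hcomp G t t' = nt_id G (end_id G)"
    using assms by (auto simp: Units_NatG_iff)
  show "nt_src t \<in> Units (EndG G)"
    using t hcomp_eq_nt_idD[OF t(3)] hcomp_eq_nt_idD[OF t(4)]
    by (auto simp: Units_EndG_iff intro!: bexI[of _ "nt_src t'"])
  show "nt_tgt t \<in> Units (EndG G)"
    using t hcomp_eq_nt_idD[OF t(3)] hcomp_eq_nt_idD[OF t(4)]
    by (auto simp: Units_EndG_iff intro!: bexI[of _ "nt_tgt t'"])
qed

lemma nt_id_Units:
  assumes "f \<in> Units (EndG G)"
  shows "nt_id G f \<in> Units (NatG G)"
proof -
  obtain g where "f \<in> ggpd_end G" "g \<in> ggpd_end G"
    "end_comp G g f = end_id G" "end_comp G f g = end_id G"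
    using assms by (auto simp: Units_EndG_iff)
  then show ?thesis
    by (auto simp: Units_NatG_iff hcomp_nt_id intro!: bexI[of _ "nt_id G g"])
qed

text \<open>Used to see that horizontal inverses of vertically composable transformations are again
  composable.\<close>

lemma end_comp_inv_unique:
  assumes "f \<in> ggpd_end G" "g \<in> ggpd_end G" "g' \<in> ggpd_end G"
    and "end_comp G g f = end_id G" "end_comp G f g' = end_id G"
  shows "g = g'"
  using monoid.inv_unique[OF monoid_EndG, of g f g'] assms by simp

lemma vcomp_Units:
  assumes t: "t \<in> Units (NatG G)" and s: "s \<in> Units (NatG G)" and st: "nt_src s = nt_tgt t"
  shows "vcomp G s t \<in> Units (NatG G)"
proof -
  obtain t' where t: "t \<in> nat_transs G" "t' \<in> nat_transs G"
    "hcomp G t' t = nt_id G (end_id G)" "hcomp G t t' = nt_id G (end_id G)"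
    using t by (auto simp: Units_NatG_iff)
  obtain s' where s: "s \<in> nat_transs G" "s' \<in> nat_transs G"
    "hcomp G s' s = nt_id G (end_id G)" "hcomp G s s' = nt_id G (end_id G)"
    using s by (auto simp: Units_NatG_iff)
  \<comment> \<open>Both functors invert \<open>nt_src s\<close>, which equals
    \<open>nt_tgt t\<close>: the first on the left, the second on the right.\<close>
  have st': "nt_src s' = nt_tgt t'"
  proof (rule end_comp_inv_unique)
    show "end_comp G (nt_src s') (nt_src s) = end_id G"
      by (rule hcomp_eq_nt_idD[OF s(3)])
    show "end_comp G (nt_src s) (nt_tgt t') = end_id G"
      using hcomp_eq_nt_idD[OF t(4)] st by simp
  qed (use s t in auto)
  \<comment> \<open>After interchange, the horizontal unit composed vertically with itself
    remains.\<close>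
  have id: "vcomp G (nt_id G (end_id G)) (nt_id G (end_id G)) = nt_id G (end_id G)"
    using vcomp_nt_id_left[of "nt_id G (end_id G)"] by simp
  have "hcomp G (vcomp G s' t') (vcomp G s t) = nt_id G (end_id G)"
    "hcomp G (vcomp G s t) (vcomp G s' t') = nt_id G (end_id G)"
    using s t st st' by (simp_all add: interchange id)
  then show ?thesis
    using s t st st' by (auto simp: Units_NatG_iff intro!: bexI[of _ "vcomp G s' t'"])
qed

lemma vinv_hcomp:
  assumes "t \<in> nat_transs G" "t' \<in> nat_transs G" "hcomp G t' t = nt_id G (end_id G)"
  shows "hcomp G (vinv t') (vinv t) = nt_id G (end_id G)"
proof -
  have src: "end_comp G (nt_src t') (nt_src t) = end_id G"
    and tgt: "end_comp G (nt_tgt t') (nt_tgt t) = end_id G"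
    by (rule hcomp_eq_nt_idD[OF assms(3)])+
  \<comment> \<open>By \<open>tgt\<close> this composite starts at \<open>end_id G\<close>, so the
    unit can be appended vertically. Read as \<open>hcomp G t' t\<close>, it lets interchange pair
    each vertical inverse with the transformation it cancels.\<close>
  have "hcomp G (vinv t') (vinv t) =
      vcomp G (hcomp G (vinv t') (vinv t)) (nt_id G (end_id G))"
    using vcomp_nt_id_right[of "hcomp G (vinv t') (vinv t)"] assms tgt by simp
  also have "\<dots> = hcomp G (vcomp G (vinv t') t') (vcomp G (vinv t) t)"
    using assms by (simp add: interchange)
  also have "\<dots> = nt_id G (end_id G)"
    using assms src by (simp add: vcomp_vinv hcomp_nt_id)
  finally show ?thesis .
qed

lemma vinv_Units: "t \<in> Units (NatG G) \<Longrightarrow> vinv t \<in> Units (NatG G)"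
  unfolding Units_NatG_iff using vinv_hcomp vinv_closed by blast

end

theorem proposition3p10:
  fixes G :: "('m, 'o) ggpd"
  assumes "group_groupoid G"
  shows "group_groupoid
    \<lparr>Mor = WG G, Obj = AutG G, src = nt_src, tgt = nt_tgt, idn = nt_id G, cmp = vcomp G\<rparr>"
proof -
  interpret group_groupoid G by fact
  have W: "t \<in> nat_transs G" "nt_src t \<in> Units (EndG G)" "nt_tgt t \<in> Units (EndG G)"
    if "t \<in> Units (NatG G)" for t
    using that nt_src_tgt_Units by (auto simp: Units_NatG_iff)
  have E: "f \<in> ggpd_end G" if "f \<in> Units (EndG G)" for f
    using that by (simp add: Units_EndG_iff)
  have H: "hcomp G s t \<in> Units (NatG G)" if "s \<in> Units (NatG G)" "t \<in> Units (NatG G)" for s t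
    using monoid.Units_m_closed[OF monoid_NatG that] by simp
  note simps = carrier_WG mult_WG carrier_AutG mult_AutG
  show ?thesis
  proof (rule group_groupoid.intro, unfold ggpd.simps simps)
    show "group (WG G)"
      unfolding WG_def by (rule monoid.units_group[OF monoid_NatG])
    show "group (AutG G)"
      unfolding AutG_eq by (rule monoid.units_group[OF monoid_EndG])
    show "nt_src \<in> hom (WG G) (AutG G)" "nt_tgt \<in> hom (WG G) (AutG G)"
      by (auto simp: hom_def simps W)
    show "nt_id G \<in> hom (AutG G) (WG G)"
      by (auto simp: hom_def simps nt_id_Units hcomp_nt_id E)
    \<comment> \<open>Products in the pullback are componentwise horizontal composites, so
      \<open>interchange\<close> is the homomorphism law and \<open>vcomp_Units\<close> gives
      closure.\<close>
    show "(\<lambda>(b, a). vcomp G b a) \<in> hom (composable \<lparr>Mor = WG G, Obj = AutG G, src = nt_src,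
        tgt = nt_tgt, idn = nt_id G, cmp = vcomp G\<rparr>) (WG G)"
      by (auto simp: hom_def composable_def DirProd_def simps vcomp_Units interchange W)
    fix t assume t: "t \<in> Units (NatG G)"
    then show "\<exists>s \<in> Units (NatG G). nt_src s = nt_tgt t \<and> nt_tgt s = nt_src t \<and>
        vcomp G s t = nt_id G (nt_src t) \<and> vcomp G t s = nt_id G (nt_tgt t)"
      by (intro bexI[of _ "vinv t"]) (simp_all add: vcomp_vinv vinv_Units W)
  \<comment> \<open>The remaining groupoid laws hold for natural transformations and functors at
    large and are inherited through \<open>W\<close> and \<open>E\<close> by regular ones and
    automorphisms.\<close>
  qed (simp_all add: W vcomp_nt_id_left vcomp_nt_id_right vcomp_assoc)
qed

end
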